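(* Let $k\ge 2$ be an integer, let $\lambda>0$, and let $0\le p\le 2k-1$ be an integer. Let $f$ be a differentiable function on $\mathbb{R}$ such that the integral below is finite, and define $$F_p(x_1,x_2):=f\left(\cos\left(\tfrac{p\pi}{k}\right)x_1+\sin\left(\tfrac{p\pi}{k}\right)x_2\right),\qquad (x_1,x_2)\in\mathbb{R}^2.$$ Then the intertwining operator $V_\lambda$ for the dihedral group $I_k$ with one parameter $\lambda$ satisfies, for all $(x_1,x_2)\in\mathbb{R}^2$, $$V_\lambda F_p(x_1,x_2)=a_\lambda^{(k)}\int_{T^{k-1}} f\left(\cos\left(\tfrac{p\pi}{k}\right)\big(c(u)x_1+s(u)x_2\big)+\sin\left(\tfrac{p\pi}{k}\right)\big(c(u)x_2-s(u)x_1\big)\right)u_0^{\lambda}\prod_{i=1}^{k-1}u_i^{\lambda-1}\,du,$$ where $u_0:=1-u_1-\cdots-u_{k-1}$, $$c(u):=\sum_{j=0}^{k-1}\cos\left(\tfrac{2j\pi}{k}\right)u_j,\qquad s(u):=\sum_{j=0}^{k-1}\sin\left(\tfrac{2j\pi}{k}\right)u_j,$$ and $a_\lambda^{(k)}$ is the constant for which $V_\lambda 1=1$, explicitly $$a_\lambda^{(k)}=\frac{\Gamma(k\lambda+1)}{\lambda\,\Gamma(\lambda)^k}.$$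
   Context: $T^{k-1}:=\{u=(u_1,\dots,u_{k-1})\in\mathbb{R}^{k-1}: u_1\ge0,\dots,u_{k-1}\ge0,\ u_1+\cdots+u_{k-1}\le 1\}$, and $du$ is Lebesgue measure on it. $I_k$ is the symmetry group of the regular $k$-gon. Its positive roots are $v_j=(\sin\frac{j\pi}{k},-\cos\frac{j\pi}{k})$, $0\le j\le k-1$, and the reflection of $x=(x_1,x_2)$ in $v_j$ is $$x\sigma_j=\left(\cos\tfrac{2j\pi}{k}\,x_1+\sin\tfrac{2j\pi}{k}\,x_2,\ \sin\tfrac{2j\pi}{k}\,x_1-\cos\tfrac{2j\pi}{k}\,x_2\right).$$ The Dunkl operators of $I_k$ with one parameter $\lambda$ are $$D_1g(x)=\frac{\partial g}{\partial x_1}+\lambda\sum_{j=0}^{k-1}\frac{g(x)-g(x\sigma_j)}{\langle x,v_j\rangle}\sin\tfrac{j\pi}{k},\qquad D_2g(x)=\frac{\partial g}{\partial x_2}-\lambda\sum_{j=0}^{k-1}\frac{g(x)-g(x\sigma_j)}{\langle x,v_j\rangle}\cos\tfrac{j\pi}{k}.$$ The intertwining operator $V_\lambda$ is the unique linear operator on polynomials in two variables such that $D_iV_\lambda=V_\lambda\partial_i$ for $i=1,2$, $V_\lambda1=1$, and $V_\lambda$ maps homogeneous polynomials of degree $n$ to homogeneous polynomials of degree $n$, for every $n\ge 0$. It is a known fact that for every $R>0$ and every polynomial $q$, $\sup_{|x|\le R}|V_\lambda q(x)|\le\sup_{|x|\le R}|q(x)|$; on non-polynomial continuous functions $V_\lambda$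 denotes the extension by continuity with respect to uniform convergence on closed discs centered at the origin. *)

theory Defs
  imports "HOL-Analysis.Analysis"
begin

text \<open>Points of the plane are pairs; the inner product and norm on \<^typ>\<open>real \<times> real\<close> are the
  Euclidean ones.\<close>

definition dihedral_root :: "nat \<Rightarrow> nat \<Rightarrow> real \<times> real" where
  "dihedral_root k j = (sin (real j * pi / real k), - cos (real j * pi / real k))"

definition dihedral_reflection :: "nat \<Rightarrow> nat \<Rightarrow> real \<times> real \<Rightarrow> real \<times> real" where
  "dihedral_reflection k j x =
    (cos (2 * real j * pi / real k) * fst x + sin (2 * real j * pi / real k) * snd x,
     sin (2 * real j * pi / real k) * fst x - cos (2 * real j * pi / real k) * snd x)"

text \<open>The quotient \<open>(g(x) - g(x \<sigma>\<^sub>j)) / \<langle>x, v\<^sub>j\<rangle>\<close> is a polynomial when \<open>g\<close> is. On the mirror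
  \<open>\<langle>x, v\<^sub>j\<rangle> = 0\<close>, where the formula reads \<open>0/0\<close>, it is understood by continuity.\<close>

definition reflection_quotient ::
  "nat \<Rightarrow> nat \<Rightarrow> (real \<times> real \<Rightarrow> real) \<Rightarrow> real \<times> real \<Rightarrow> real" where
  "reflection_quotient k j g x =
    (let q = (\<lambda>y. (g y - g (dihedral_reflection k j y)) / (y \<bullet> dihedral_root k j))
     in if x \<bullet> dihedral_root k j \<noteq> 0 then q x
        else Lim (at x within {y. y \<bullet> dihedral_root k j \<noteq> 0}) q)"

definition partial1 :: "(real \<times> real \<Rightarrow> real) \<Rightarrow> real \<times> real \<Rightarrow> real" where
  "partial1 g x = deriv (\<lambda>t. g (t, snd x)) (fst x)"

definition partial2 :: "(real \<times> real \<Rightarrow> real) \<Rightarrow> real \<times> real \<Rightarrow> real" where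
  "partial2 g x = deriv (\<lambda>t. g (fst x, t)) (snd x)"

definition dunkl1 ::
  "nat \<Rightarrow> real \<Rightarrow> (real \<times> real \<Rightarrow> real) \<Rightarrow> real \<times> real \<Rightarrow> real" where
  "dunkl1 k lam g x =
    partial1 g x + lam * (\<Sum>j<k. reflection_quotient k j g x * sin (real j * pi / real k))"

definition dunkl2 ::
  "nat \<Rightarrow> real \<Rightarrow> (real \<times> real \<Rightarrow> real) \<Rightarrow> real \<times> real \<Rightarrow> real" where
  "dunkl2 k lam g x =
    partial2 g x - lam * (\<Sum>j<k. reflection_quotient k j g x * cos (real j * pi / real k))"

definition homogeneous_poly :: "nat \<Rightarrow> (real \<times> real \<Rightarrow> real) \<Rightarrow> bool" where
  "homogeneous_poly n g \<longleftrightarrow>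
    (\<exists>c :: nat \<Rightarrow> real. \<forall>x. g x = (\<Sum>i\<le>n. c i * fst x ^ i * snd x ^ (n - i)))"

text \<open>Polynomials over \<open>\<real>\<close> in two variables are identified with polynomial functions, so an operator
  on polynomials is a map on functions of which only the restriction to polynomial functions is
  constrained.\<close>

definition intertwining_on_polynomials ::
  "nat \<Rightarrow> real \<Rightarrow> ((real \<times> real \<Rightarrow> real) \<Rightarrow> (real \<times> real \<Rightarrow> real)) \<Rightarrow> bool" where
  "intertwining_on_polynomials k lam V \<longleftrightarrow>
    (\<forall>g. real_polynomial_function g \<longrightarrow> real_polynomial_function (V g)) \<and>
    (\<forall>g h. real_polynomial_function g \<longrightarrow> real_polynomial_function h \<longrightarrow>
       V (\<lambda>x. g x + h x) = (\<lambda>x. V g x + V h x)) \<and>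
    (\<forall>a g. real_polynomial_function g \<longrightarrow> V (\<lambda>x. a * g x) = (\<lambda>x. a * V g x)) \<and>
    (\<forall>n g. homogeneous_poly n g \<longrightarrow> homogeneous_poly n (V g)) \<and>
    V (\<lambda>x. 1) = (\<lambda>x. 1) \<and>
    (\<forall>g. real_polynomial_function g \<longrightarrow> dunkl1 k lam (V g) = V (partial1 g)) \<and>
    (\<forall>g. real_polynomial_function g \<longrightarrow> dunkl2 k lam (V g) = V (partial2 g))"

text \<open>Convergence uniformly on closed discs centred at the origin.\<close>

definition converges_on_discs ::
  "(nat \<Rightarrow> real \<times> real \<Rightarrow> real) \<Rightarrow> (real \<times> real \<Rightarrow> real) \<Rightarrow> bool" where
  "converges_on_discs q g \<longleftrightarrow> (\<forall>R>0. uniform_limit (cball 0 R) q g sequentially)"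

text \<open>The intertwining operator, acting on continuous functions. The conditions determine \<open>V g\<close> for
  every continuous \<open>g\<close>: those on polynomials have a unique solution, and polynomials are dense in the
  continuous functions for convergence on discs. That the extension exists is a theorem of Roesler
  (on each disc, \<open>V\<close> does not increase the supremum norm of a polynomial).\<close>

definition intertwining_operator ::
  "nat \<Rightarrow> real \<Rightarrow> ((real \<times> real \<Rightarrow> real) \<Rightarrow> (real \<times> real \<Rightarrow> real)) \<Rightarrow> bool" where
  "intertwining_operator k lam V \<longleftrightarrow>
    intertwining_on_polynomials k lam V \<and>
    (\<forall>g q. continuous_on UNIV g \<longrightarrow> (\<forall>n. real_polynomial_function (q n)) \<longrightarrow>
       converges_on_discs q g \<longrightarrow> converges_on_discs (\<lambda>n. V (q n)) (V g))"

text \<open>\<open>\<real>\<^bsup>k-1\<^esup>\<close> is rendered as the extensional functions on the index set \<open>{1..k-1}\<close>, which is the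
  space of the product measure below.\<close>

definition lebesgue_coords :: "nat \<Rightarrow> (nat \<Rightarrow> real) measure" where
  "lebesgue_coords k = PiM {1..k-1} (\<lambda>_. lborel)"

definition simplex_T :: "nat \<Rightarrow> (nat \<Rightarrow> real) set" where
  "simplex_T k = {u \<in> {1..k-1} \<rightarrow>\<^sub>E UNIV. (\<forall>i\<in>{1..k-1}. 0 \<le> u i) \<and> (\<Sum>i=1..k-1. u i) \<le> 1}"

definition bary :: "nat \<Rightarrow> (nat \<Rightarrow> real) \<Rightarrow> nat \<Rightarrow> real" where
  "bary k u j = (if j = 0 then 1 - (\<Sum>i=1..k-1. u i) else u j)"

definition c_fun :: "nat \<Rightarrow> (nat \<Rightarrow> real) \<Rightarrow> real" where
  "c_fun k u = (\<Sum>j<k. cos (2 * real j * pi / real k) * bary k u j)"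

definition s_fun :: "nat \<Rightarrow> (nat \<Rightarrow> real) \<Rightarrow> real" where
  "s_fun k u = (\<Sum>j<k. sin (2 * real j * pi / real k) * bary k u j)"

definition dirichlet_weight :: "nat \<Rightarrow> real \<Rightarrow> (nat \<Rightarrow> real) \<Rightarrow> real" where
  "dirichlet_weight k lam u = bary k u 0 powr lam * (\<Prod>i=1..k-1. u i powr (lam - 1))"

definition ridge_integrand ::
  "nat \<Rightarrow> real \<Rightarrow> nat \<Rightarrow> (real \<Rightarrow> real) \<Rightarrow> real \<Rightarrow> real \<Rightarrow> (nat \<Rightarrow> real) \<Rightarrow> real" where
  "ridge_integrand k lam p f x1 x2 u =
    f (cos (real p * pi / real k) * (c_fun k u * x1 + s_fun k u * x2)
       + sin (real p * pi / real k) * (c_fun k u * x2 - s_fun k u * x1))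
    * dirichlet_weight k lam u"

definition a_const :: "nat \<Rightarrow> real \<Rightarrow> real" where
  "a_const k lam = Gamma (real k * lam + 1) / (lam * Gamma lam ^ k)"

end

theory Submission
  imports Defs
begin

text \<open>Let \<open>\<ell>(x) = \<langle>x, e\<rangle>\<close> with \<open>e\<close> on a mirror, so that the orbit of \<open>e\<close> has \<open>k\<close> points \<open>e\<^sub>j\<close>, and put
  \<open>y\<^sub>j = \<langle>x, e\<^sub>j\<rangle>\<close>. The claimed value of \<open>V \<ell>\<^sup>n\<close> is \<open>G\<^sub>n(x)\<close>, the \<open>n\<close>-th moment of \<open>\<Sum> u\<^sub>j y\<^sub>j\<close> under the
  Dirichlet distribution with parameters \<open>(\<lambda> + 1, \<lambda>, \<dots>, \<lambda>)\<close>. Contracting the relations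
  \<open>D\<^sub>i V = V \<partial>\<^sub>i\<close> with \<open>x\<close> gives, by Euler's identity,
  \<open>n h + \<lambda> \<Sum>\<^sub>j (h - h \<circ> \<sigma>\<^sub>j) = n \<ell> V \<ell>\<^bsup>n-1\<^esup>\<close> for \<open>h = V \<ell>\<^sup>n\<close>. For \<open>n > 0\<close> this equation has at most one
  continuous solution: at a maximum of the difference of two solutions on a disc all summands are
  nonnegative. That \<open>G\<^sub>n\<close> solves it follows from integration by parts for Dirichlet moments, since
  reflections only move the index carrying the parameter \<open>\<lambda> + 1\<close>. Weierstrass
  approximation passes from powers to \<open>f\<close>.\<close>

section \<open>Moments of Dirichlet distributions\<close>

definition raise_at :: "('a \<Rightarrow> real) \<Rightarrow> 'a \<Rightarrow> 'a \<Rightarrow> real" where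
  "raise_at \<alpha> i j = (if j = i then \<alpha> j + 1 else \<alpha> j)"

text \<open>The moments are normalized so that they are the integrals of \<open>(\<Sum> y\<^sub>j u\<^sub>j)\<^sup>n \<Prod> u\<^sub>j powr (\<alpha>\<^sub>j - 1)\<close>;
  a factor \<open>u\<^sub>j\<close> raises \<open>\<alpha>\<^sub>j\<close> by one. In this recursive form the symmetry in the barycentric
  coordinates, hidden by the choice of the dependent coordinate \<open>u\<^sub>0\<close>, is evident.\<close>

primrec dirichlet_moment :: "'a set \<Rightarrow> ('a \<Rightarrow> real) \<Rightarrow> nat \<Rightarrow> ('a \<Rightarrow> real) \<Rightarrow> real" where
  "dirichlet_moment S y 0 \<alpha> = (\<Prod>j\<in>S. Gamma (\<alpha> j)) / Gamma (\<Sum>j\<in>S. \<alpha> j)"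
| "dirichlet_moment S y (Suc n) \<alpha> = (\<Sum>j\<in>S. y j * dirichlet_moment S y n (raise_at \<alpha> j))"

lemma raise_at_commute: "raise_at (raise_at \<alpha> i) j = raise_at (raise_at \<alpha> j) i"
  by (auto simp: fun_eq_iff raise_at_def)

lemma sum_raise_at:
  assumes "finite S" "i \<in> S"
  shows "(\<Sum>j\<in>S. raise_at \<alpha> i j) = (\<Sum>j\<in>S. \<alpha> j) + 1"
  using assms by (simp add: raise_at_def sum.remove[of S i])

lemma raise_at_pos: "(\<And>j. j \<in> S \<Longrightarrow> \<alpha> j > 0) \<Longrightarrow> j \<in> S \<Longrightarrow> raise_at \<alpha> i j > 0"
  by (auto simp: raise_at_def add_pos_pos)

lemma Gamma_real_plus1: "x > 0 \<Longrightarrow> Gamma (x + 1) = x * Gamma (x :: real)"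
  by (rule Gamma_plus1) (auto elim!: nonpos_Ints_cases)

text \<open>The mean of the \<open>i\<close>-th coordinate is \<alpha>_i divided by the total; this
  is \<open>Gamma (x + 1) = x * Gamma x\<close> applied once in the numerator and once in the
  denominator.\<close>

lemma dirichlet_moment_0_raise:
  assumes S: "finite S" "i \<in> S" and pos: "\<And>j. j \<in> S \<Longrightarrow> \<alpha> j > 0"
  shows "(\<Sum>j\<in>S. \<alpha> j) * dirichlet_moment S y 0 (raise_at \<alpha> i) = \<alpha> i * dirichlet_moment S y 0 \<alpha>"
proof -
  have sum_pos: "(\<Sum>j\<in>S. \<alpha> j) > 0"
    using S pos by (intro sum_pos) auto
  have "(\<Prod>j\<in>S. Gamma (raise_at \<alpha> i j)) = Gamma (\<alpha> i + 1) * (\<Prod>j\<in>S - {i}. Gamma (\<alpha> j))"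
    using S by (simp add: raise_at_def prod.remove[of S i])
  also have "\<dots> = \<alpha> i * (\<Prod>j\<in>S. Gamma (\<alpha> j))"
    using S pos[of i] by (simp add: prod.remove[of S i] Gamma_real_plus1)
  finally have "(\<Prod>j\<in>S. Gamma (raise_at \<alpha> i j)) = \<alpha> i * (\<Prod>j\<in>S. Gamma (\<alpha> j))" .
  moreover have "Gamma (\<Sum>j\<in>S. raise_at \<alpha> i j) = (\<Sum>j\<in>S. \<alpha> j) * Gamma (\<Sum>j\<in>S. \<alpha> j)"
    unfolding sum_raise_at[OF S] using sum_pos by (simp add: Gamma_real_plus1)
  ultimately show ?thesis
    using sum_pos by (simp only: dirichlet_moment.simps) (simp add: Gamma_real_pos)
qed

text \<open>This is integration by parts in the \<open>i\<close>-th of independent gamma variables,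
  where the radial integration contributes the factor total plus \<open>n\<close>. The proof is
  purely algebraic: one factor of the moment is expanded, and the induction hypothesis is used at
  the raised parameters, which is why \<alpha> is generalized.\<close>

lemma dirichlet_moment_stein:
  assumes S: "finite S" "i \<in> S" and pos: "\<And>j. j \<in> S \<Longrightarrow> \<alpha> j > 0"
  shows "((\<Sum>j\<in>S. \<alpha> j) + real n) * dirichlet_moment S y n (raise_at \<alpha> i)
       = \<alpha> i * dirichlet_moment S y n \<alpha>
         + real n * y i * dirichlet_moment S y (n - 1) (raise_at \<alpha> i)"
  using pos
proof (induction n arbitrary: \<alpha>)
  case 0
  then show ?case using dirichlet_moment_0_raise[OF S 0] by simp
next
  case (Suc n)
  let ?M = "dirichlet_moment S y"
  define A where "A = (\<Sum>j\<in>S. \<alpha> j)"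
  \<comment> \<open>The induction hypothesis at \<open>raise_at \<alpha> j\<close>: the total has
    grown by one, and the \<open>i\<close>-th parameter has grown exactly when \<open>j = i\<close>.
    That extra one supplies the additional copy of
    \<open>y i * ?M n (raise_at \<alpha> i)\<close>.\<close>
  have step: "(A + 1 + real n) * ?M n (raise_at (raise_at \<alpha> i) j)
      = (\<alpha> i + (if j = i then 1 else 0)) * ?M n (raise_at \<alpha> j)
        + real n * y i * ?M (n - 1) (raise_at (raise_at \<alpha> i) j)" if "j \<in> S" for j
  proof -
    have "((\<Sum>l\<in>S. raise_at \<alpha> j l) + real n) * ?M n (raise_at (raise_at \<alpha> j) i)
        = raise_at \<alpha> j i * ?M n (raise_at \<alpha> j)
          + real n * y i * ?M (n - 1) (raise_at (raise_at \<alpha> j) i)"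
      by (intro Suc.IH raise_at_pos Suc.prems)
    then show ?thesis
      using that S by (auto simp: raise_at_commute[of \<alpha> i j] sum_raise_at A_def raise_at_def[of \<alpha> j i])
  qed
  \<comment> \<open>For \<open>n = 0\<close> the factor \<open>real n\<close> hides the truncated
    \<open>n - 1\<close>; otherwise the sum is the recursion for the moment of order
    \<open>n\<close>.\<close>
  have last: "real n * (\<Sum>j\<in>S. y j * ?M (n - 1) (raise_at (raise_at \<alpha> i) j))
      = real n * ?M n (raise_at \<alpha> i)"
    by (cases n) auto
  have "(A + real (Suc n)) * ?M (Suc n) (raise_at \<alpha> i)
      = (\<Sum>j\<in>S. y j * ((A + 1 + real n) * ?M n (raise_at (raise_at \<alpha> i) j)))"
    by (simp only: dirichlet_moment.simps sum_distrib_left) (simp add: algebra_simps)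
  also have "\<dots> = (\<Sum>j\<in>S. \<alpha> i * (y j * ?M n (raise_at \<alpha> j))
        + (if j = i then y i * ?M n (raise_at \<alpha> i) else 0)
        + y i * (real n * (y j * ?M (n - 1) (raise_at (raise_at \<alpha> i) j))))"
    by (intro sum.cong refl) (simp only: step, auto simp: algebra_simps)
  also have "\<dots> = \<alpha> i * ?M (Suc n) \<alpha> + y i * ?M n (raise_at \<alpha> i)
        + y i * (real n * ?M n (raise_at \<alpha> i))"
    unfolding last[symmetric]
    using S by (simp add: sum.distrib sum_distrib_left)
  finally show ?case
    by (simp only: A_def diff_Suc_1) (simp add: algebra_simps)
qed

text \<open>The coordinates of a point of the simplex sum to one, so inserting the factor
  \<open>\<Sum> u_i\<close> under the integral changes nothing.\<close>

lemma sum_dirichlet_moment_raise: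
  assumes S: "finite S" "S \<noteq> {}" and pos: "\<And>j. j \<in> S \<Longrightarrow> \<alpha> j > 0"
  shows "(\<Sum>i\<in>S. dirichlet_moment S y n (raise_at \<alpha> i)) = dirichlet_moment S y n \<alpha>"
  using pos
proof (induction n arbitrary: \<alpha>)
  case 0
  define A where "A = (\<Sum>j\<in>S. \<alpha> j)"
  have A: "A > 0"
    unfolding A_def using S 0 by (intro sum_pos) auto
  have "A * (\<Sum>i\<in>S. dirichlet_moment S y 0 (raise_at \<alpha> i))
      = (\<Sum>i\<in>S. \<alpha> i * dirichlet_moment S y 0 \<alpha>)"
    unfolding sum_distrib_left A_def
    by (intro sum.cong refl dirichlet_moment_0_raise S 0)
  also have "\<dots> = A * dirichlet_moment S y 0 \<alpha>"
    by (simp only: A_def sum_distrib_right)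
  finally show ?case using A by (simp only: mult_cancel_left) auto
next
  case (Suc n)
  have *: "(\<Sum>i\<in>S. dirichlet_moment S y n (raise_at (raise_at \<alpha> j) i))
       = dirichlet_moment S y n (raise_at \<alpha> j)" if "j \<in> S" for j
    using Suc.prems by (intro Suc.IH raise_at_pos)
  have "(\<Sum>i\<in>S. dirichlet_moment S y (Suc n) (raise_at \<alpha> i))
      = (\<Sum>j\<in>S. y j * (\<Sum>i\<in>S. dirichlet_moment S y n (raise_at (raise_at \<alpha> i) j)))"
    by (simp only: dirichlet_moment.simps sum_distrib_left) (rule sum.swap)
  also have "\<dots> = (\<Sum>j\<in>S. y j * (\<Sum>i\<in>S. dirichlet_moment S y n (raise_at (raise_at \<alpha> j) i)))"
    by (simp only: raise_at_commute)
  also have "\<dots> = dirichlet_moment S y (Suc n) \<alpha>"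
    by (simp add: *)
  finally show ?case .
qed

text \<open>The recursion sees the index set only through sums and products over it, which a
  relabelling preserves; raising at \<open>j\<close> before the relabelling is raising at
  \<open>\<tau> j\<close> after it.\<close>

lemma dirichlet_moment_permute:
  assumes \<tau>: "bij_betw \<tau> S S" and \<beta>: "\<And>j. j \<in> S \<Longrightarrow> \<beta> j = \<alpha> (\<tau> j)"
  shows "dirichlet_moment S (\<lambda>j. y (\<tau> j)) n \<beta> = dirichlet_moment S y n \<alpha>"
  using \<beta>
proof (induction n arbitrary: \<alpha> \<beta>)
  case 0
  have "(\<Prod>j\<in>S. Gamma (\<beta> j)) = (\<Prod>j\<in>S. Gamma (\<alpha> j))"
    using prod.reindex_bij_betw[OF \<tau>, of "\<lambda>j. Gamma (\<alpha> j)"] 0 by simp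
  moreover have "(\<Sum>j\<in>S. \<beta> j) = (\<Sum>j\<in>S. \<alpha> j)"
    using sum.reindex_bij_betw[OF \<tau>, of \<alpha>] 0 by simp
  ultimately show ?case by simp
next
  case (Suc n)
  have inj: "\<tau> i = \<tau> j \<longleftrightarrow> i = j" if "i \<in> S" "j \<in> S" for i j
    using \<tau> that by (auto simp: bij_betw_def inj_on_def)
  have "dirichlet_moment S (\<lambda>j. y (\<tau> j)) n (raise_at \<beta> j)
      = dirichlet_moment S y n (raise_at \<alpha> (\<tau> j))" if "j \<in> S" for j
    using that Suc.prems by (intro Suc.IH) (auto simp: inj raise_at_def)
  then show ?case
    using sum.reindex_bij_betw[OF \<tau>, of "\<lambda>j. y j * dirichlet_moment S y n (raise_at \<alpha> j)"]
    by simp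
qed

lemma continuous_on_dirichlet_moment:
  assumes "\<And>j. j \<in> S \<Longrightarrow> continuous_on X (\<lambda>x. y x j)"
  shows "continuous_on X (\<lambda>x. dirichlet_moment S (y x) n \<alpha>)"
  by (induction n arbitrary: \<alpha>) (auto intro!: continuous_intros assms)

section \<open>The Dirichlet integral\<close>

text \<open>Cutting the power off at \<open>0\<close> makes the Dirichlet weight vanish outside the simplex, so that
  no indicator function has to be carried along.\<close>

definition cut_powr :: "real \<Rightarrow> real \<Rightarrow> real" where
  "cut_powr x c = (if x > 0 then x powr (c - 1) else 0)"

lemma cut_powr_nonneg [simp]: "cut_powr x c \<ge> 0"
  by (simp add: cut_powr_def)

lemma borel_measurable_cut_powr [measurable]:
  assumes [measurable]: "f \<in> borel_measurable M"
  shows "(\<lambda>u. cut_powr (f u) c) \<in> borel_measurable M"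
  unfolding cut_powr_def by measurable

lemma cut_powr_eq: "x \<ge> 0 \<Longrightarrow> cut_powr x c = x powr (c - 1)"
  by (auto simp: cut_powr_def)

lemma mult_cut_powr: "x * cut_powr x c = cut_powr x (c + 1)"
  by (auto simp: cut_powr_def powr_mult_base)

text \<open>Cut powers are closed under convolution up to a Beta factor. The substitution of
  \<open>s * x\<close> for \<open>x\<close> reduces the case \<open>s > 0\<close> to the Beta
  integral on the unit interval.\<close>

lemma nn_integral_cut_powr_Beta:
  assumes b: "b > 0" and c: "c > 0"
  shows "(\<integral>\<^sup>+x. ennreal (cut_powr x b * cut_powr (s - x) c) \<partial>lborel)
       = ennreal (Gamma b * Gamma c / Gamma (b + c) * cut_powr s (b + c))"
proof (cases "s > 0")
  case False
  then have "cut_powr x b * cut_powr (s - x) c = 0" for x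
    by (auto simp: cut_powr_def)
  with False show ?thesis by (simp only: cut_powr_def[of s]) simp
next
  case s: True
  have unit: "(\<integral>\<^sup>+x. ennreal (cut_powr x b * cut_powr (1 - x) c) \<partial>lborel) = ennreal (Beta b c)"
  proof -
    have "((\<lambda>x. cut_powr x b * cut_powr (1 - x) c) has_integral Beta b c) {0..1}"
      using has_integral_Beta_real[OF b c]
      by (rule has_integral_eq[rotated]) (auto simp: cut_powr_eq)
    then have "((\<lambda>x. cut_powr x b * cut_powr (1 - x) c) has_integral Beta b c) UNIV"
      by (rule has_integral_on_superset) (auto simp: cut_powr_def)
    then show ?thesis
      by (intro nn_integral_has_integral_lborel) auto
  qed
  have scale: "cut_powr (s * x) b * cut_powr (s - s * x) c
      = s powr (b + c - 2) * (cut_powr x b * cut_powr (1 - x) c)" for x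
  proof (cases "0 < x \<and> x < 1")
    case True
    have "s - s * x = s * (1 - x)" by (simp add: algebra_simps)
    moreover have "s powr (b + c - 2) = s powr (b - 1) * s powr (c - 1)"
      by (simp flip: powr_add)
    ultimately show ?thesis
      using s True by (simp add: cut_powr_def powr_mult)
  next
    case False
    have "s - s * x > 0 \<longleftrightarrow> x < 1" "s * x > 0 \<longleftrightarrow> x > 0"
      using s by (simp_all add: zero_less_mult_iff)
    with False s show ?thesis by (auto simp: cut_powr_def)
  qed
  have "(\<integral>\<^sup>+x. ennreal (cut_powr x b * cut_powr (s - x) c) \<partial>lborel)
      = ennreal s * (\<integral>\<^sup>+x. ennreal (cut_powr (s * x) b * cut_powr (s - s * x) c) \<partial>lborel)"
    using s by (subst nn_integral_real_affine[where c = s and t = 0]) auto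
  also have "\<dots> = ennreal s * (ennreal (s powr (b + c - 2)) * ennreal (Beta b c))"
    unfolding scale using unit by (simp add: ennreal_mult' nn_integral_cmult)
  also have "\<dots> = ennreal (Beta b c * (s * s powr (b + c - 2)))"
    using s b c
    by (simp add: ennreal_mult' Beta_def Gamma_real_pos mult.commute mult.left_commute
        flip: ennreal_mult)
  also have "s * s powr (b + c - 2) = cut_powr s (b + c)"
    using s by (simp add: cut_powr_def powr_mult_base)
  finally show ?thesis by (simp add: Beta_def)
qed

text \<open>One coordinate \<open>y\<close> is integrated last, and the inner integral is the same
  one with \<open>s - y\<close> in place of \<open>s\<close>; hence the induction needs arbitrary
  \<open>s\<close>, although only \<open>s = 1\<close> is used later. The remaining integral over
  \<open>y\<close> is the convolution above. The parameter \<open>a\<close> belongs to the dependent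
  coordinate.\<close>

lemma nn_integral_dirichlet:
  assumes "finite I" and "\<And>i. i \<in> I \<Longrightarrow> b i > 0" and "a > 0"
  shows "(\<integral>\<^sup>+u. ennreal (cut_powr (s - (\<Sum>i\<in>I. u i)) a * (\<Prod>i\<in>I. cut_powr (u i) (b i)))
            \<partial>PiM I (\<lambda>_. lborel))
       = ennreal (Gamma a * (\<Prod>i\<in>I. Gamma (b i)) / Gamma (a + (\<Sum>i\<in>I. b i))
            * cut_powr s (a + (\<Sum>i\<in>I. b i)))"
  using assms(1,2)
proof (induction I arbitrary: s rule: finite_induct)
  case empty
  show ?case
    using Gamma_real_pos[OF \<open>a > 0\<close>] by (simp add: PiM_empty nn_integral_count_space_finite)
next
  case (insert i I)
  interpret product_sigma_finite "\<lambda>_. lborel :: real measure" ..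
  define B where "B = a + (\<Sum>i\<in>I. b i)"
  define C where "C = Gamma a * (\<Prod>i\<in>I. Gamma (b i)) / Gamma B"
  have B: "B > 0"
    unfolding B_def using insert.prems \<open>a > 0\<close> by (intro add_pos_nonneg sum_nonneg) (auto intro: less_imp_le)
  have C: "C \<ge> 0"
    unfolding C_def using insert.prems \<open>a > 0\<close> B
    by (intro divide_nonneg_nonneg mult_nonneg_nonneg prod_nonneg) (auto intro!: less_imp_le Gamma_real_pos)
  have "(\<integral>\<^sup>+u. ennreal (cut_powr (s - (\<Sum>j\<in>insert i I. u j)) a
            * (\<Prod>j\<in>insert i I. cut_powr (u j) (b j))) \<partial>PiM (insert i I) (\<lambda>_. lborel))
      = (\<integral>\<^sup>+y. \<integral>\<^sup>+u. ennreal (cut_powr (s - (\<Sum>j\<in>insert i I. (u(i := y)) j)) a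
            * (\<Prod>j\<in>insert i I. cut_powr ((u(i := y)) j) (b j))) \<partial>PiM I (\<lambda>_. lborel) \<partial>lborel)"
    using insert.hyps by (intro product_nn_integral_insert_rev) auto
  also have "\<dots> = (\<integral>\<^sup>+y. ennreal (cut_powr y (b i)) * (\<integral>\<^sup>+u. ennreal (cut_powr ((s - y) - (\<Sum>j\<in>I. u j)) a
            * (\<Prod>j\<in>I. cut_powr (u j) (b j))) \<partial>PiM I (\<lambda>_. lborel)) \<partial>lborel)"
  proof (intro nn_integral_cong)
    fix y
    have [simp]: "(\<Sum>j\<in>I. if j = i then y else u j) = (\<Sum>j\<in>I. u j)"
      "(\<Prod>j\<in>I. cut_powr (if j = i then y else u j) (b j)) = (\<Prod>j\<in>I. cut_powr (u j) (b j))" for u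
      using insert.hyps by (auto intro!: sum.cong prod.cong)
    have "cut_powr (s - (\<Sum>j\<in>insert i I. (u(i := y)) j)) a
            * (\<Prod>j\<in>insert i I. cut_powr ((u(i := y)) j) (b j))
        = cut_powr y (b i) * (cut_powr ((s - y) - (\<Sum>j\<in>I. u j)) a
            * (\<Prod>j\<in>I. cut_powr (u j) (b j)))" for u
      using insert.hyps by (simp add: diff_diff_eq)
    then show "(\<integral>\<^sup>+u. ennreal (cut_powr (s - (\<Sum>j\<in>insert i I. (u(i := y)) j)) a
            * (\<Prod>j\<in>insert i I. cut_powr ((u(i := y)) j) (b j))) \<partial>PiM I (\<lambda>_. lborel))
        = ennreal (cut_powr y (b i)) * (\<integral>\<^sup>+u. ennreal (cut_powr ((s - y) - (\<Sum>j\<in>I. u j)) a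
            * (\<Prod>j\<in>I. cut_powr (u j) (b j))) \<partial>PiM I (\<lambda>_. lborel))"
      by (simp only: ennreal_mult'[OF cut_powr_nonneg]) (rule nn_integral_cmult, measurable)
  qed
  also have "\<dots> = (\<integral>\<^sup>+y. ennreal C * ennreal (cut_powr y (b i) * cut_powr (s - y) B) \<partial>lborel)"
  proof (intro nn_integral_cong)
    fix y
    have "(\<integral>\<^sup>+u. ennreal (cut_powr ((s - y) - (\<Sum>j\<in>I. u j)) a
            * (\<Prod>j\<in>I. cut_powr (u j) (b j))) \<partial>PiM I (\<lambda>_. lborel)) = ennreal (C * cut_powr (s - y) B)"
      unfolding C_def B_def using insert.prems by (intro insert.IH) auto
    then show "ennreal (cut_powr y (b i)) * (\<integral>\<^sup>+u. ennreal (cut_powr ((s - y) - (\<Sum>j\<in>I. u j)) a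
            * (\<Prod>j\<in>I. cut_powr (u j) (b j))) \<partial>PiM I (\<lambda>_. lborel))
        = ennreal C * ennreal (cut_powr y (b i) * cut_powr (s - y) B)"
      using C by (simp add: ennreal_mult ennreal_mult' ac_simps)
  qed
  also have "\<dots> = ennreal C * ennreal (Gamma (b i) * Gamma B / Gamma (b i + B) * cut_powr s (b i + B))"
    using B insert.prems
    by (subst nn_integral_cmult) (auto simp: nn_integral_cut_powr_Beta)
  also have "\<dots> = ennreal (C * (Gamma (b i) * Gamma B / Gamma (b i + B) * cut_powr s (b i + B)))"
    by (simp only: ennreal_mult'[OF C])
  also have "C * (Gamma (b i) * Gamma B / Gamma (b i + B) * cut_powr s (b i + B))
      = Gamma a * (\<Prod>i\<in>insert i I. Gamma (b i)) / Gamma (a + (\<Sum>i\<in>insert i I. b i))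
            * cut_powr s (a + (\<Sum>i\<in>insert i I. b i))"
  proof -
    have total: "b i + B = a + (\<Sum>i\<in>insert i I. b i)"
      using insert.hyps by (simp add: B_def)
    show ?thesis
      unfolding total using insert.hyps Gamma_real_pos[OF B] by (simp add: C_def)
  qed
  finally show ?case .
qed

section \<open>Moments as integrals over the simplex\<close>

lemma lessThan_eq_insert_0: "k \<ge> 1 \<Longrightarrow> {..<k} = insert 0 {1..k - 1}" for k :: nat
  by auto

definition simplex_weight :: "nat \<Rightarrow> (nat \<Rightarrow> real) \<Rightarrow> (nat \<Rightarrow> real) \<Rightarrow> real" where
  "simplex_weight k \<alpha> u = (\<Prod>j<k. cut_powr (bary k u j) (\<alpha> j))"

lemma simplex_weight_nonneg [simp]: "simplex_weight k \<alpha> u \<ge> 0"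
  by (simp add: simplex_weight_def prod_nonneg)

lemma borel_measurable_bary [measurable]:
  "j < k \<Longrightarrow> (\<lambda>u. bary k u j) \<in> borel_measurable (lebesgue_coords k)"
  unfolding bary_def lebesgue_coords_def by (cases "j = 0") auto

lemma borel_measurable_simplex_weight [measurable]:
  "simplex_weight k \<alpha> \<in> borel_measurable (lebesgue_coords k)"
  unfolding simplex_weight_def by (intro borel_measurable_prod borel_measurable_cut_powr) auto

lemma bary_mult_simplex_weight:
  assumes "i < k"
  shows "bary k u i * simplex_weight k \<alpha> u = simplex_weight k (raise_at \<alpha> i) u"
proof -
  have "(\<Prod>j\<in>{..<k} - {i}. cut_powr (bary k u j) (raise_at \<alpha> i j))
      = (\<Prod>j\<in>{..<k} - {i}. cut_powr (bary k u j) (\<alpha> j))"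
    by (intro prod.cong) (auto simp: raise_at_def)
  then show ?thesis
    using assms
    by (simp add: simplex_weight_def prod.remove[of "{..<k}" i] mult_cut_powr raise_at_def
        flip: mult.assoc)
qed

text \<open>Splitting off one factor \<open>\<Sum> y_j u_j\<close> and absorbing each
  \<open>u_j\<close> into the weight reproduces the recursion of \<open>dirichlet_moment\<close>;
  order \<open>0\<close> is the Dirichlet integral with \<open>s = 1\<close>.\<close>

lemma has_bochner_integral_simplex_moment:
  assumes k: "k \<ge> 1" and pos: "\<And>j. j < k \<Longrightarrow> \<alpha> j > 0"
  shows "has_bochner_integral (lebesgue_coords k)
           (\<lambda>u. (\<Sum>j<k. y j * bary k u j) ^ n * simplex_weight k \<alpha> u)
           (dirichlet_moment {..<k} y n \<alpha>)"
  using pos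
proof (induction n arbitrary: \<alpha>)
  case 0
  have weight: "simplex_weight k \<alpha> u
      = cut_powr (1 - (\<Sum>i=1..k-1. u i)) (\<alpha> 0) * (\<Prod>i=1..k-1. cut_powr (u i) (\<alpha> i))" for u
    using k by (simp add: simplex_weight_def lessThan_eq_insert_0 bary_def)
  have moment: "dirichlet_moment {..<k} y 0 \<alpha>
      = Gamma (\<alpha> 0) * (\<Prod>i=1..k-1. Gamma (\<alpha> i)) / Gamma (\<alpha> 0 + (\<Sum>i=1..k-1. \<alpha> i))
          * cut_powr 1 (\<alpha> 0 + (\<Sum>i=1..k-1. \<alpha> i))"
    using k by (simp add: lessThan_eq_insert_0 cut_powr_def)
  have "(\<integral>\<^sup>+u. ennreal (simplex_weight k \<alpha> u) \<partial>lebesgue_coords k)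
      = ennreal (dirichlet_moment {..<k} y 0 \<alpha>)"
    unfolding weight moment lebesgue_coords_def using 0 k by (intro nn_integral_dirichlet) auto
  moreover have "dirichlet_moment {..<k} y 0 \<alpha> \<ge> 0"
    using 0 k
    by (auto intro!: divide_nonneg_nonneg prod_nonneg less_imp_le[OF Gamma_real_pos] sum_pos
        simp: lessThan_empty_iff)
  ultimately show ?case
    by (intro has_bochner_integral_nn_integral) auto
next
  case (Suc n)
  have "has_bochner_integral (lebesgue_coords k)
     (\<lambda>u. \<Sum>j<k. y j * ((\<Sum>i<k. y i * bary k u i) ^ n * simplex_weight k (raise_at \<alpha> j) u))
     (\<Sum>j<k. y j * dirichlet_moment {..<k} y n (raise_at \<alpha> j))"
    using Suc.prems
    by (intro has_bochner_integral_sum has_bochner_integral_mult_right Suc.IH)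
      (auto simp: raise_at_def add_pos_pos)
  moreover have "(\<Sum>i<k. y i * bary k u i) ^ Suc n * simplex_weight k \<alpha> u
      = (\<Sum>j<k. y j * ((\<Sum>i<k. y i * bary k u i) ^ n * simplex_weight k (raise_at \<alpha> j) u))" for u
    by (simp add: sum_distrib_right mult.assoc mult.left_commute flip: bary_mult_simplex_weight)
  ultimately show ?case by simp
qed

section \<open>Dunkl operators on homogeneous polynomials\<close>

lemma homogeneous_poly_euler:
  assumes "homogeneous_poly n h"
  shows "fst x * partial1 h x + snd x * partial2 h x = real n * h x"
proof -
  obtain c where "\<forall>x. h x = (\<Sum>i\<le>n. c i * fst x ^ i * snd x ^ (n - i))"
    using assms unfolding homogeneous_poly_def by blast
  then have h: "h = (\<lambda>x. \<Sum>i\<le>n. c i * fst x ^ i * snd x ^ (n - i))"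
    by (intro ext) blast
  have p1: "partial1 h x = (\<Sum>i\<le>n. c i * (real i * fst x ^ (i - 1)) * snd x ^ (n - i))"
    unfolding partial1_def h
    by (rule DERIV_imp_deriv) (auto intro!: derivative_eq_intros sum.cong)
  have p2: "partial2 h x = (\<Sum>i\<le>n. c i * fst x ^ i * (real (n - i) * snd x ^ (n - i - 1)))"
    unfolding partial2_def h
    by (rule DERIV_imp_deriv) (auto intro!: derivative_eq_intros sum.cong)
  \<comment> \<open>The case \<open>m = 0\<close> is harmless despite the truncated exponent, since
    both sides then carry the factor \<open>0\<close>.\<close>
  have pow: "t * (real m * t ^ (m - 1)) = real m * t ^ m" for t :: real and m
    by (cases m) auto
  have "fst x * (c i * (real i * fst x ^ (i - 1)) * snd x ^ (n - i))
      + snd x * (c i * fst x ^ i * (real (n - i) * snd x ^ (n - i - 1)))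
      = real n * (c i * fst x ^ i * snd x ^ (n - i))" if "i \<le> n" for i
  proof -
    have "fst x * (c i * (real i * fst x ^ (i - 1)) * snd x ^ (n - i))
        + snd x * (c i * fst x ^ i * (real (n - i) * snd x ^ (n - i - 1)))
        = c i * (fst x * (real i * fst x ^ (i - 1))) * snd x ^ (n - i)
        + c i * fst x ^ i * (snd x * (real (n - i) * snd x ^ (n - i - 1)))"
      by (simp only: ac_simps)
    also have "\<dots> = (real i + real (n - i)) * (c i * fst x ^ i * snd x ^ (n - i))"
      unfolding pow by (simp add: algebra_simps)
    also have "real i + real (n - i) = real n"
      using that by simp
    finally show ?thesis .
  qed
  then show ?thesis
    unfolding p1 p2 by (simp add: h sum_distrib_left flip: sum.distrib)
qed

text \<open>The double-angle formulas turn the matrix form into the usual formula for reflection in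
  a unit root, from which it is evident that points of the mirror are fixed.\<close>

lemma dihedral_reflection_eq:
  "dihedral_reflection k j x = x - (2 * (x \<bullet> dihedral_root k j)) *\<^sub>R dihedral_root k j"
proof -
  define \<phi> where "\<phi> = real j * pi / real k"
  have angle: "2 * real j * pi / real k = 2 * \<phi>" by (simp add: \<phi>_def)
  have "cos (2 * \<phi>) * a + sin (2 * \<phi>) * b = a - 2 * (a * sin \<phi> - b * cos \<phi>) * sin \<phi>" for a b
    unfolding cos_double_sin sin_double by algebra
  moreover have "sin (2 * \<phi>) * a - cos (2 * \<phi>) * b = b + 2 * (a * sin \<phi> - b * cos \<phi>) * cos \<phi>" for a b
    unfolding cos_double_cos sin_double by algebra
  ultimately show ?thesis
    unfolding dihedral_reflection_def dihedral_root_def angle \<phi>_def[symmetric]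
    by (cases x) simp
qed

lemma norm_dihedral_reflection [simp]: "norm (dihedral_reflection k j x) = norm x"
proof -
  have "(cos t * a + sin t * b)\<^sup>2 + (sin t * a - cos t * b)\<^sup>2 = a\<^sup>2 + b\<^sup>2" for t a b :: real
  proof -
    have "(cos t * a + sin t * b)\<^sup>2 + (sin t * a - cos t * b)\<^sup>2
        = ((sin t)\<^sup>2 + (cos t)\<^sup>2) * (a\<^sup>2 + b\<^sup>2)"
      by algebra
    then show ?thesis by simp
  qed
  then show ?thesis
    by (simp add: dihedral_reflection_def norm_prod_def)
qed

text \<open>On the mirror the value of the quotient, whatever it is, is annihilated by the factor
  \<open>\<langle>x, v\<^sub>j\<rangle>\<close>, so the limit in its definition never has to be computed.\<close>

lemma reflection_quotient_mult:
  "reflection_quotient k j h x * (x \<bullet> dihedral_root k j) = h x - h (dihedral_reflection k j x)"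
  by (cases "x \<bullet> dihedral_root k j = 0")
    (auto simp: reflection_quotient_def Let_def dihedral_reflection_eq)

text \<open>Contraction with \<open>x\<close> assembles the sines and cosines into
  \<open>x \<bullet> dihedral_root k j\<close>, which cancels the denominators of the difference
  quotients.\<close>

lemma dunkl_euler:
  assumes "homogeneous_poly n h"
  shows "fst x * dunkl1 k lam h x + snd x * dunkl2 k lam h x
       = real n * h x + lam * (\<Sum>j<k. h x - h (dihedral_reflection k j x))"
proof -
  have "fst x * dunkl1 k lam h x + snd x * dunkl2 k lam h x
      = (fst x * partial1 h x + snd x * partial2 h x)
        + lam * (\<Sum>j<k. reflection_quotient k j h x * (x \<bullet> dihedral_root k j))"
    by (cases x) (simp add: dunkl1_def dunkl2_def dihedral_root_def algebra_simps sum_distrib_left sum.distrib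
        sum_subtractf)
  then show ?thesis
    by (simp only: reflection_quotient_mult homogeneous_poly_euler[OF assms])
qed

lemma dunkl_maximum_principle:
  fixes h :: "real \<times> real \<Rightarrow> real"
  assumes cont: "continuous_on UNIV h" and n: "n > 0" and lam: "lam \<ge> 0"
    and eq: "\<And>x. real n * h x + lam * (\<Sum>j<k. h x - h (dihedral_reflection k j x)) = 0"
  shows "h x \<le> 0"
proof -
  \<comment> \<open>The disc of radius \<open>norm x\<close> contains \<open>x\<close> and is
    invariant under all reflections, so the value at \<open>z\<close> dominates the values at its
    mirror images.\<close>
  obtain z where z: "z \<in> cball 0 (norm x)" "\<And>y. y \<in> cball 0 (norm x) \<Longrightarrow> h y \<le> h z"
    using continuous_attains_sup[of "cball 0 (norm x)" h] continuous_on_subset[OF cont] by auto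
  have "h z - h (dihedral_reflection k j z) \<ge> 0" for j
    using z(2)[of "dihedral_reflection k j z"] z(1) by simp
  then have "lam * (\<Sum>j<k. h z - h (dihedral_reflection k j z)) \<ge> 0"
    using lam by (intro mult_nonneg_nonneg sum_nonneg) auto
  with eq[of z] n have "h z \<le> 0"
    by (smt (verit) mult_pos_pos of_nat_0_less_iff)
  moreover have "h x \<le> h z" by (intro z(2)) simp
  ultimately show ?thesis by simp
qed

section \<open>The orbit of a ridge direction\<close>

text \<open>The inner product of \<open>x\<close> with the \<open>i\<close>-th unit vector of the
  orbit; index \<open>0\<close> gives the ridge form itself.\<close>

definition orbit_coord :: "nat \<Rightarrow> nat \<Rightarrow> real \<times> real \<Rightarrow> nat \<Rightarrow> real" where
  "orbit_coord k p x i = cos (real p * pi / real k + 2 * real i * pi / real k) * fst x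
                       + sin (real p * pi / real k + 2 * real i * pi / real k) * snd x"

text \<open>The \<open>j\<close>-th reflection sends the direction of angle \<open>t\<close> to that
  of angle \<open>2 * j * pi / k - t\<close>. For \<open>t = (p + 2 * i) * pi / k\<close> this is
  the orbit direction of index \<open>j - p - i\<close>, read modulo \<open>k\<close>; integers are
  used because the difference may be negative.\<close>

definition orbit_perm :: "nat \<Rightarrow> nat \<Rightarrow> nat \<Rightarrow> nat \<Rightarrow> nat" where
  "orbit_perm k p j i = nat ((int j - int p - int i) mod int k)"

lemma orbit_coord_reflection:
  assumes "k > 0"
  shows "orbit_coord k p (dihedral_reflection k j x) i = orbit_coord k p x (orbit_perm k p j i)"
proof -
  define q where "q = (int j - int p - int i) div int k"
  define A where "A = real p * pi / real k + 2 * real i * pi / real k"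
  define B where "B = 2 * real j * pi / real k"
  have "int (orbit_perm k p j i) = int j - int p - int i - int k * q"
    using assms by (simp add: orbit_perm_def q_def minus_mult_div_eq_mod)
  then have "real_of_int (int (orbit_perm k p j i))
      = real_of_int (int j - int p - int i - int k * q)" by (rule arg_cong)
  then have perm: "real (orbit_perm k p j i) = real j - real p - real i - real k * real_of_int q"
    by simp
  \<comment> \<open>Reducing the index modulo \<open>k\<close> changes the angle by \<open>q\<close>
    full turns.\<close>
  then have angle: "real p * pi / real k + 2 * real (orbit_perm k p j i) * pi / real k
      = (B - A) - 2 * pi * real_of_int q"
    unfolding A_def B_def perm using assms by (simp add: field_simps)
  show ?thesis
    unfolding orbit_coord_def angle dihedral_reflection_def A_def[symmetric] B_def[symmetric]
      cos_diff[of "B - A"] sin_diff[of "B - A"] cos_int_2pin sin_int_2pin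
    by (simp add: cos_diff sin_diff algebra_simps)
qed

text \<open>Distinct indices below \<open>k\<close> have images differing by less than
  \<open>k\<close>, hence by no multiple of \<open>k\<close>; an injective self-map of a finite set
  is onto.\<close>

lemma bij_betw_mod:
  assumes k: "k > 0" and g: "\<And>i j. \<bar>g i - g j\<bar> = \<bar>int i - int j\<bar>"
  shows "bij_betw (\<lambda>i. nat (g i mod int k)) {..<k} {..<k}"
proof -
  have inj: "inj_on (\<lambda>i. nat (g i mod int k)) {..<k}"
  proof (rule inj_onI)
    fix i j assume ij: "i \<in> {..<k}" "j \<in> {..<k}" "nat (g i mod int k) = nat (g j mod int k)"
    then have "g i mod int k = g j mod int k"
      using k by (simp add: eq_nat_nat_iff)
    then have "int k dvd \<bar>g i - g j\<bar>"
      by (simp add: mod_eq_dvd_iff)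
    then have "int k dvd \<bar>int i - int j\<bar>"
      unfolding g .
    moreover have "\<bar>int i - int j\<bar> < int k"
      using ij by auto
    ultimately show "i = j"
      using zdvd_not_zless[of "\<bar>int i - int j\<bar>" "int k"] by linarith
  qed
  moreover have "(\<lambda>i. nat (g i mod int k)) ` {..<k} \<subseteq> {..<k}"
    using k by (auto simp: nat_less_iff)
  ultimately show ?thesis
    by (simp add: bij_betw_def endo_inj_surj)
qed

lemma abs_orbit_coord_le: "\<bar>orbit_coord k p x i\<bar> \<le> norm x"
proof -
  have "orbit_coord k p x i = (cos (real p * pi / real k + 2 * real i * pi / real k),
      sin (real p * pi / real k + 2 * real i * pi / real k)) \<bullet> x"
    by (cases x) (simp add: orbit_coord_def)
  also have "\<bar>\<dots>\<bar> \<le> norm (cos (real p * pi / real k + 2 * real i * pi / real k),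
      sin (real p * pi / real k + 2 * real i * pi / real k)) * norm x"
    by (rule Cauchy_Schwarz_ineq2)
  finally show ?thesis by (simp add: norm_prod_def)
qed

lemma bij_betw_orbit_perm: "k > 0 \<Longrightarrow> bij_betw (orbit_perm k p j) {..<k} {..<k}"
  unfolding orbit_perm_def by (rule bij_betw_mod) auto

text \<open>Here the reflection varies: the \<open>k\<close> reflections carry index
  \<open>0\<close> to each index exactly once. This turns a sum over reflections into a sum over
  raised positions.\<close>

lemma bij_betw_orbit_perm_0: "k > 0 \<Longrightarrow> bij_betw (\<lambda>j. orbit_perm k p j 0) {..<k} {..<k}"
  unfolding orbit_perm_def by (rule bij_betw_mod) auto

text \<open>The candidate for the image of the \<open>n\<close>-th power of the ridge form. The
  raised parameter sits at index \<open>0\<close>, that is, at the ridge direction.\<close>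

definition ridge_moment :: "nat \<Rightarrow> real \<Rightarrow> nat \<Rightarrow> nat \<Rightarrow> real \<times> real \<Rightarrow> real" where
  "ridge_moment k lam p n x =
     a_const k lam * dirichlet_moment {..<k} (orbit_coord k p x) n (raise_at (\<lambda>_. lam) 0)"

text \<open>The parameters sum to \<open>k * lam + 1\<close> and their Gamma values multiply to
  \<open>lam * Gamma lam ^ k\<close>, so \<open>a_const\<close> is the reciprocal of the total
  mass.\<close>

lemma ridge_moment_0:
  assumes "k > 0" "lam > 0"
  shows "ridge_moment k lam p 0 x = 1"
proof -
  have "(\<Prod>j<k. Gamma (raise_at (\<lambda>_. lam) 0 j)) = Gamma (lam + 1) * Gamma lam ^ (k - 1)"
    using assms by (simp add: lessThan_eq_insert_0 raise_at_def)
  also have "\<dots> = lam * Gamma lam ^ k"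
    using assms by (simp add: Gamma_real_plus1 power_eq_if[of _ k])
  finally have "(\<Prod>j<k. Gamma (raise_at (\<lambda>_. lam) 0 j)) = lam * Gamma lam ^ k" .
  moreover have "Gamma (real k * lam + 1) > 0"
    using assms by (intro Gamma_real_pos add_nonneg_pos) auto
  ultimately show ?thesis
    using assms less_imp_neq[OF Gamma_real_pos[OF assms(2)], symmetric]
    by (simp add: ridge_moment_def a_const_def sum_raise_at)
qed

lemma ridge_moment_dunkl:
  assumes k: "k > 0" and lam: "lam > 0"
  shows "real n * ridge_moment k lam p n x
           + lam * (\<Sum>j<k. ridge_moment k lam p n x
                            - ridge_moment k lam p n (dihedral_reflection k j x))
       = real n * orbit_coord k p x 0 * ridge_moment k lam p (n - 1) x"
proof -
  let ?M = "\<lambda>n. dirichlet_moment {..<k} (orbit_coord k p x) n"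
  let ?\<alpha> = "\<lambda>_::nat. lam"
  \<comment> \<open>Reflecting the point permutes the orbit coordinates; undoing the permutation
    moves the raised parameter from \<open>0\<close> to \<open>orbit_perm k p j 0\<close>.\<close>
  have refl: "ridge_moment k lam p n (dihedral_reflection k j x)
      = a_const k lam * ?M n (raise_at ?\<alpha> (orbit_perm k p j 0))" for j
  proof -
    have bij: "bij_betw (orbit_perm k p j) {..<k} {..<k}"
      using k by (rule bij_betw_orbit_perm)
    have "orbit_perm k p j i = orbit_perm k p j 0 \<longleftrightarrow> i = 0" if "i < k" for i
      using bij that k by (auto simp: bij_betw_def inj_on_def)
    then show ?thesis
      unfolding ridge_moment_def orbit_coord_reflection[OF k]
      by (intro arg_cong2[where f = "(*)"] refl dirichlet_moment_permute[OF bij])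
        (auto simp: raise_at_def)
  qed
  have "(\<Sum>j<k. ridge_moment k lam p n (dihedral_reflection k j x))
      = a_const k lam * (\<Sum>j<k. ?M n (raise_at ?\<alpha> (orbit_perm k p j 0)))"
    by (simp add: refl sum_distrib_left)
  also have "(\<Sum>j<k. ?M n (raise_at ?\<alpha> (orbit_perm k p j 0))) = (\<Sum>i<k. ?M n (raise_at ?\<alpha> i))"
    by (rule sum.reindex_bij_betw[OF bij_betw_orbit_perm_0[OF k]])
  also have "\<dots> = ?M n ?\<alpha>"
    using k lam by (intro sum_dirichlet_moment_raise) (auto simp: lessThan_empty_iff)
  finally have sum: "(\<Sum>j<k. ridge_moment k lam p n (dihedral_reflection k j x))
      = a_const k lam * ?M n ?\<alpha>" .
  have stein: "(real k * lam + real n) * ?M n (raise_at ?\<alpha> 0)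
      = lam * ?M n ?\<alpha> + real n * orbit_coord k p x 0 * ?M (n - 1) (raise_at ?\<alpha> 0)"
    using dirichlet_moment_stein[of "{..<k}" 0 ?\<alpha> n "orbit_coord k p x"] k lam by simp
  \<comment> \<open>The unreflected terms contribute \<open>k * lam\<close>, the reflected ones the
    moment with no raised parameter; together they are the two outer terms of
    \<open>stein\<close>.\<close>
  have "real n * ridge_moment k lam p n x
           + lam * (\<Sum>j<k. ridge_moment k lam p n x
                            - ridge_moment k lam p n (dihedral_reflection k j x))
      = a_const k lam * ((real k * lam + real n) * ?M n (raise_at ?\<alpha> 0) - lam * ?M n ?\<alpha>)"
    unfolding sum_subtractf sum by (simp add: ridge_moment_def algebra_simps)
  also have "\<dots> = real n * orbit_coord k p x 0 * ridge_moment k lam p (n - 1) x"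
    unfolding stein by (simp add: ridge_moment_def)
  finally show ?thesis .
qed

lemma continuous_on_ridge_moment: "continuous_on X (ridge_moment k lam p n)"
  unfolding ridge_moment_def orbit_coord_def
  by (intro continuous_intros continuous_on_dirichlet_moment)

section \<open>The intertwining operator on ridge functions\<close>

lemma real_polynomial_function_fst_snd:
  "real_polynomial_function (fst :: real \<times> real \<Rightarrow> real)"
  "real_polynomial_function (snd :: real \<times> real \<Rightarrow> real)"
  by (auto intro: real_polynomial_function.intros(1) bounded_linear_fst bounded_linear_snd)

lemma real_polynomial_function_ridge:
  "real_polynomial_function (\<lambda>x::real \<times> real. a * fst x + b * snd x)"
  by (intro real_polynomial_function.intros(2-) real_polynomial_function_fst_snd)

lemma homogeneous_poly_ridge_power:
  "homogeneous_poly n (\<lambda>x. (a * fst x + b * snd x) ^ n)"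
  unfolding homogeneous_poly_def
  by (rule exI[of _ "\<lambda>i. of_nat (n choose i) * a ^ i * b ^ (n - i)"])
    (auto simp: binomial_ring power_mult_distrib ac_simps intro!: sum.cong)

lemma homogeneous_poly_continuous:
  assumes "homogeneous_poly n h"
  shows "continuous_on X h"
proof -
  obtain c where "\<forall>x. h x = (\<Sum>i\<le>n. c i * fst x ^ i * snd x ^ (n - i))"
    using assms unfolding homogeneous_poly_def by blast
  then have h: "h = (\<lambda>x. \<Sum>i\<le>n. c i * fst x ^ i * snd x ^ (n - i))"
    by (intro ext) blast
  show ?thesis unfolding h by (intro continuous_intros)
qed

lemma partial_ridge_power:
  "partial1 (\<lambda>x. (a * fst x + b * snd x) ^ n) = (\<lambda>x. (real n * a) * (a * fst x + b * snd x) ^ (n - 1))"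
  "partial2 (\<lambda>x. (a * fst x + b * snd x) ^ n) = (\<lambda>x. (real n * b) * (a * fst x + b * snd x) ^ (n - 1))"
  unfolding partial1_def partial2_def
  by (auto intro!: ext DERIV_imp_deriv derivative_eq_intros simp: mult_ac)

lemma intertwining_on_polynomialsD:
  assumes "intertwining_on_polynomials k lam V"
  shows "real_polynomial_function g \<Longrightarrow> real_polynomial_function h \<Longrightarrow>
      V (\<lambda>x. g x + h x) = (\<lambda>x. V g x + V h x)"
    and "real_polynomial_function g \<Longrightarrow> V (\<lambda>x. c * g x) = (\<lambda>x. c * V g x)"
    and "homogeneous_poly n g \<Longrightarrow> homogeneous_poly n (V g)"
    and "V (\<lambda>x. 1) = (\<lambda>x. 1)"
    and "real_polynomial_function g \<Longrightarrow> dunkl1 k lam (V g) = V (partial1 g)"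
    and "real_polynomial_function g \<Longrightarrow> dunkl2 k lam (V g) = V (partial2 g)"
  using assms by (auto simp: intertwining_on_polynomials_def)

text \<open>By induction the right-hand side of the Euler equation for degree \<open>Suc n\<close>
  is known and agrees for both functions. The maximum principle applied to their difference and to
  its negative gives equality.\<close>

lemma intertwining_ridge_power:
  fixes p :: nat
  assumes k: "k > 0" and lam: "lam > 0" and V: "intertwining_on_polynomials k lam V"
  defines "a \<equiv> cos (real p * pi / real k)" and "b \<equiv> sin (real p * pi / real k)"
  shows "V (\<lambda>x. (a * fst x + b * snd x) ^ n) = ridge_moment k lam p n"
proof (induction n)
  \<comment> \<open>In degree \<open>0\<close> the Euler equation leaves the constant free; the
    normalization \<open>V 1 = 1\<close> fixes it.\<close>
  case 0
  show ?case
    using intertwining_on_polynomialsD(4)[OF V] ridge_moment_0[OF k lam] by auto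
next
  case (Suc n)
  let ?r = "\<lambda>x::real \<times> real. a * fst x + b * snd x"
  let ?h = "V (\<lambda>x. ?r x ^ Suc n)"
  let ?G = "ridge_moment k lam p (Suc n)"
  have poly: "real_polynomial_function (\<lambda>x. ?r x ^ m)" for m
    by (intro real_polynomial_function_power real_polynomial_function_ridge)
  have hom: "homogeneous_poly (Suc n) ?h"
    by (rule intertwining_on_polynomialsD(3)[OF V homogeneous_poly_ridge_power])
  have scale: "V (\<lambda>x. c * ?r x ^ n) = (\<lambda>x. c * ridge_moment k lam p n x)" for c
    unfolding Suc.IH[symmetric] by (rule intertwining_on_polynomialsD(2)[OF V poly])
  have "dunkl1 k lam ?h = V (partial1 (\<lambda>x. ?r x ^ Suc n))"
    by (rule intertwining_on_polynomialsD(5)[OF V poly])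
  then have d1: "dunkl1 k lam ?h = (\<lambda>x. real (Suc n) * a * ridge_moment k lam p n x)"
    by (simp only: partial_ridge_power diff_Suc_1 scale)
  have "dunkl2 k lam ?h = V (partial2 (\<lambda>x. ?r x ^ Suc n))"
    by (rule intertwining_on_polynomialsD(6)[OF V poly])
  then have d2: "dunkl2 k lam ?h = (\<lambda>x. real (Suc n) * b * ridge_moment k lam p n x)"
    by (simp only: partial_ridge_power diff_Suc_1 scale)
  have eq_h: "real (Suc n) * ?h x + lam * (\<Sum>j<k. ?h x - ?h (dihedral_reflection k j x))
      = real (Suc n) * ?r x * ridge_moment k lam p n x" for x
    unfolding dunkl_euler[OF hom, symmetric] d1 d2 by (simp only: algebra_simps)
  have eq_G: "real (Suc n) * ?G x + lam * (\<Sum>j<k. ?G x - ?G (dihedral_reflection k j x))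
      = real (Suc n) * ?r x * ridge_moment k lam p n x" for x
    using ridge_moment_dunkl[OF k lam, of "Suc n" p x] by (simp add: orbit_coord_def a_def b_def)
  have cont: "continuous_on UNIV ?h" "continuous_on UNIV ?G"
    using homogeneous_poly_continuous[OF hom] continuous_on_ridge_moment by auto
  have "?h x - ?G x \<le> 0" for x
  proof (rule dunkl_maximum_principle[of "\<lambda>x. ?h x - ?G x" "Suc n" lam k])
    fix x
    show "real (Suc n) * (?h x - ?G x)
        + lam * (\<Sum>j<k. ?h x - ?G x - (?h (dihedral_reflection k j x) - ?G (dihedral_reflection k j x))) = 0"
      using eq_h[of x] eq_G[of x] by (simp only: sum_subtractf right_diff_distrib)
  qed (use cont lam in \<open>auto intro!: continuous_intros\<close>)
  moreover have "?G x - ?h x \<le> 0" for x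
  proof (rule dunkl_maximum_principle[of "\<lambda>x. ?G x - ?h x" "Suc n" lam k])
    fix x
    show "real (Suc n) * (?G x - ?h x)
        + lam * (\<Sum>j<k. ?G x - ?h x - (?G (dihedral_reflection k j x) - ?h (dihedral_reflection k j x))) = 0"
      using eq_h[of x] eq_G[of x] by (simp only: sum_subtractf right_diff_distrib)
  qed (use cont lam in \<open>auto intro!: continuous_intros\<close>)
  ultimately show ?case
    by (intro ext antisym) (simp_all only: diff_le_0_iff_le)
qed

section \<open>Ridge functions integrated over the simplex\<close>

definition simplex_ridge :: "nat \<Rightarrow> nat \<Rightarrow> real \<times> real \<Rightarrow> (nat \<Rightarrow> real) \<Rightarrow> real" where
  "simplex_ridge k p x u = (\<Sum>j<k. orbit_coord k p x j * bary k u j)"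

abbreviation ridge_weight :: "nat \<Rightarrow> real \<Rightarrow> (nat \<Rightarrow> real) \<Rightarrow> real" where
  "ridge_weight k lam \<equiv> simplex_weight k (raise_at (\<lambda>_. lam) 0)"

text \<open>The angle addition formulas identify the combination of orbit coordinates with the
  argument of \<open>f\<close> in the integral formula.\<close>

lemma simplex_ridge_eq:
  "simplex_ridge k p (x1, x2) u =
     cos (real p * pi / real k) * (c_fun k u * x1 + s_fun k u * x2)
     + sin (real p * pi / real k) * (c_fun k u * x2 - s_fun k u * x1)"
  by (simp add: simplex_ridge_def orbit_coord_def c_fun_def s_fun_def cos_add sin_add algebra_simps
      sum_distrib_left sum.distrib sum_subtractf)

text \<open>On the faces both weights vanish because \<open>0 powr c = 0\<close>; off the simplex
  some barycentric coordinate is negative. Restricting \<open>u\<close> to the space of the measure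
  makes it extensional, as membership in \<open>simplex_T\<close> demands.\<close>

lemma indicator_mult_dirichlet_weight:
  assumes k: "k \<ge> 1" and u: "u \<in> space (lebesgue_coords k)"
  shows "indicator (simplex_T k) u * dirichlet_weight k lam u = ridge_weight k lam u"
proof -
  have weight: "ridge_weight k lam u
      = cut_powr (bary k u 0) (lam + 1) * (\<Prod>i=1..k-1. cut_powr (u i) lam)"
    using k by (simp add: simplex_weight_def lessThan_eq_insert_0 raise_at_def bary_def)
  have ext: "u \<in> {1..k - 1} \<rightarrow>\<^sub>E UNIV"
    using u by (simp add: lebesgue_coords_def space_PiM)
  show ?thesis
  proof (cases "u \<in> simplex_T k")
    case True
    then have "bary k u 0 \<ge> 0" "\<And>i. i \<in> {1..k-1} \<Longrightarrow> u i \<ge> 0"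
      by (auto simp: simplex_T_def bary_def)
    then show ?thesis
      using True by (simp add: weight dirichlet_weight_def cut_powr_eq)
  next
    case False
    then consider "bary k u 0 < 0" | i where "i \<in> {1..k-1}" "u i < 0"
      using ext by (force simp: simplex_T_def bary_def)
    then have "ridge_weight k lam u = 0"
      unfolding weight
    proof cases
      case (2 i)
      then have "\<exists>i\<in>{1..k-1}. cut_powr (u i) lam = 0"
        by (auto simp: cut_powr_def intro!: bexI[of _ i])
      then have "(\<Prod>i=1..k-1. cut_powr (u i) lam) = 0"
        by (simp add: prod_zero_iff)
      then show "cut_powr (bary k u 0) (lam + 1) * (\<Prod>i=1..k-1. cut_powr (u i) lam) = 0"
        by (simp only: mult_zero_right)
    qed (simp add: cut_powr_def)
    with False show ?thesis by simp
  qed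
qed

lemma indicator_mult_ridge_integrand:
  assumes "k \<ge> 1" and "u \<in> space (lebesgue_coords k)"
  shows "indicator (simplex_T k) u *\<^sub>R ridge_integrand k lam p f x1 x2 u
       = f (simplex_ridge k p (x1, x2) u) * ridge_weight k lam u"
  by (simp add: ridge_integrand_def simplex_ridge_eq indicator_mult_dirichlet_weight[OF assms, symmetric])

text \<open>Where the weight is nonzero the barycentric coordinates are nonnegative with sum one, so
  the value is a convex combination of orbit coordinates, each bounded by
  \<open>norm x\<close>.\<close>

lemma abs_simplex_ridge_le:
  assumes k: "k \<ge> 1" and u: "ridge_weight k lam u \<noteq> 0"
  shows "\<bar>simplex_ridge k p x u\<bar> \<le> norm x"
proof -
  have "bary k u j \<ge> 0" if "j < k" for j
  proof -
    have "cut_powr (bary k u j) (raise_at (\<lambda>_. lam) 0 j) \<noteq> 0"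
      using u that by (simp add: simplex_weight_def)
    then show ?thesis by (auto simp: cut_powr_def split: if_splits)
  qed
  then have "\<bar>simplex_ridge k p x u\<bar> \<le> (\<Sum>j<k. norm x * bary k u j)"
    unfolding simplex_ridge_def
    by (intro order.trans[OF sum_abs] sum_mono) (auto simp: abs_mult intro!: mult_right_mono abs_orbit_coord_le)
  also have "\<dots> = norm x"
    using k by (simp add: lessThan_eq_insert_0 bary_def flip: sum_distrib_left)
  finally show ?thesis .
qed

lemma has_bochner_integral_ridge_moment:
  assumes "k > 0" "lam > 0"
  shows "has_bochner_integral (lebesgue_coords k)
     (\<lambda>u. a_const k lam * (simplex_ridge k p x u ^ n * ridge_weight k lam u)) (ridge_moment k lam p n x)"
  unfolding ridge_moment_def simplex_ridge_def
  using assms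
  by (intro has_bochner_integral_mult_right has_bochner_integral_simplex_moment)
    (auto simp: raise_at_def)

lemma has_bochner_integral_ridge_weight:
  assumes "k > 0" "lam > 0"
  shows "has_bochner_integral (lebesgue_coords k) (\<lambda>u. a_const k lam * ridge_weight k lam u) 1"
  \<comment> \<open>At order \<open>0\<close> the integrand depends on neither the direction nor the
    point, so arbitrary values are inserted.\<close>
  using has_bochner_integral_ridge_moment[OF assms, of 0 undefined 0] ridge_moment_0[OF assms] by simp

lemma intertwining_ridge_polynomial:
  fixes p :: nat
  assumes k: "k > 0" and lam: "lam > 0" and V: "intertwining_on_polynomials k lam V"
    and q: "real_polynomial_function q"
  defines "a \<equiv> cos (real p * pi / real k)" and "b \<equiv> sin (real p * pi / real k)"
  shows "has_bochner_integral (lebesgue_coords k)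
      (\<lambda>u. a_const k lam * (q (simplex_ridge k p x u) * ridge_weight k lam u))
      (V (\<lambda>x. q (a * fst x + b * snd x)) x)"
proof -
  let ?r = "\<lambda>x::real \<times> real. a * fst x + b * snd x"
  obtain c n where q: "q = (\<lambda>t. \<Sum>i\<le>n. c i * t ^ i)"
    using q real_polynomial_function_iff_sum by blast
  have power: "V (\<lambda>x. ?r x ^ i) = ridge_moment k lam p i" for i
    unfolding a_def b_def by (rule intertwining_ridge_power[OF k lam V])
  have poly: "real_polynomial_function (\<lambda>x. c i * ?r x ^ i)" for i
    by (intro real_polynomial_function.intros(2-) real_polynomial_function_power real_polynomial_function_ridge)
  have scale: "V (\<lambda>x. c i * ?r x ^ i) = (\<lambda>x. c i * ridge_moment k lam p i x)" for i
  proof -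
    have "real_polynomial_function (\<lambda>x. ?r x ^ i)"
      by (intro real_polynomial_function_power real_polynomial_function_ridge)
    then show ?thesis
      unfolding power[symmetric] by (rule intertwining_on_polynomialsD(2)[OF V])
  qed
  have "V (\<lambda>x. \<Sum>i\<le>n. c i * ?r x ^ i) = (\<lambda>x. \<Sum>i\<le>n. c i * ridge_moment k lam p i x)"
  proof (induction n)
    case 0
    then show ?case using scale[of 0] by simp
  next
    case (Suc n)
    have "real_polynomial_function (\<lambda>x. \<Sum>i\<le>n. c i * ?r x ^ i)"
      by (intro real_polynomial_function_sum poly) auto
    then have "V (\<lambda>x. (\<Sum>i\<le>n. c i * ?r x ^ i) + c (Suc n) * ?r x ^ Suc n)
        = (\<lambda>x. V (\<lambda>x. \<Sum>i\<le>n. c i * ?r x ^ i) x + V (\<lambda>x. c (Suc n) * ?r x ^ Suc n) x)"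
      by (rule intertwining_on_polynomialsD(1)[OF V _ poly])
    then show ?case by (simp only: Suc.IH scale sum.atMost_Suc)
  qed
  moreover have "has_bochner_integral (lebesgue_coords k)
      (\<lambda>u. \<Sum>i\<le>n. c i * (a_const k lam * (simplex_ridge k p x u ^ i * ridge_weight k lam u)))
      (\<Sum>i\<le>n. c i * ridge_moment k lam p i x)"
    by (intro has_bochner_integral_sum has_bochner_integral_mult_right
        has_bochner_integral_ridge_moment k lam)
  ultimately show ?thesis
    unfolding q by (simp add: sum_distrib_left sum_distrib_right mult_ac)
qed

section \<open>From polynomials to continuous functions\<close>

lemma polynomial_approximation_real:
  assumes "continuous_on UNIV (f :: real \<Rightarrow> real)"
  obtains q where "\<And>n. real_polynomial_function (q n)"
    "\<And>n t. \<bar>t\<bar> \<le> real n \<Longrightarrow> \<bar>f t - q n t\<bar> < inverse (real (Suc n))"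
proof -
  \<comment> \<open>Interval and error are tied to the same \<open>n\<close>, so that a single
    sequence converges uniformly on every bounded set.\<close>
  have "\<exists>q. real_polynomial_function q \<and> (\<forall>t. \<bar>t\<bar> \<le> real n \<longrightarrow> \<bar>f t - q t\<bar> < inverse (real (Suc n)))" for n
  proof -
    obtain q where "real_polynomial_function q"
        "\<And>t. t \<in> {-real n..real n} \<Longrightarrow> \<bar>f t - q t\<bar> < inverse (real (Suc n))"
      by (rule Stone_Weierstrass_real_polynomial_function[of "{-real n..real n}" f "inverse (real (Suc n))"])
        (use assms in \<open>auto intro: continuous_on_subset\<close>)
    then show ?thesis by (auto simp: abs_le_iff)
  qed
  then show ?thesis using that by metis
qed

text \<open>The values at \<open>x\<close> of \<open>V\<close> on the approximating ridge
  polynomials have two limits: one by the continuity of \<open>V\<close> on discs, the other by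
  passing to the limit in the integral formula. They coincide.\<close>

lemma intertwining_ridge:
  fixes p :: nat
  assumes k: "k > 0" and lam: "lam > 0" and V: "intertwining_operator k lam V"
    and f: "continuous_on UNIV f"
    and int: "integrable (lebesgue_coords k) (\<lambda>u. f (simplex_ridge k p x u) * ridge_weight k lam u)"
  defines "a \<equiv> cos (real p * pi / real k)" and "b \<equiv> sin (real p * pi / real k)"
  shows "V (\<lambda>x. f (a * fst x + b * snd x)) x
    = a_const k lam * (\<integral>u. f (simplex_ridge k p x u) * ridge_weight k lam u \<partial>lebesgue_coords k)"
proof -
  let ?r = "\<lambda>x::real \<times> real. a * fst x + b * snd x"
  let ?L = "lebesgue_coords k" and ?w = "ridge_weight k lam" and ?A = "a_const k lam"
  obtain q where q: "\<And>n. real_polynomial_function (q n)"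
    and approx: "\<And>n t. \<bar>t\<bar> \<le> real n \<Longrightarrow> \<bar>f t - q n t\<bar> < inverse (real (Suc n))"
    using polynomial_approximation_real[OF f] by blast
  have ridge_le: "\<bar>?r y\<bar> \<le> norm y" for y
    using abs_orbit_coord_le[of k p y 0] by (simp add: orbit_coord_def a_def b_def)
  have "converges_on_discs (\<lambda>n x. q n (?r x)) (\<lambda>x. f (?r x))"
    unfolding converges_on_discs_def
  proof (intro allI impI uniform_limitI)
    fix R e :: real assume "e > 0"
    have "\<forall>\<^sub>F n in sequentially. inverse (real (Suc n)) < e"
      using order_tendstoD(2)[OF LIMSEQ_inverse_real_of_nat \<open>e > 0\<close>] .
    moreover have "\<forall>\<^sub>F n in sequentially. R \<le> real n"
      using filterlim_real_sequentially unfolding filterlim_at_top by blast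
    ultimately show "\<forall>\<^sub>F n in sequentially. \<forall>y\<in>cball 0 R. dist (q n (?r y)) (f (?r y)) < e"
    proof eventually_elim
      case (elim n)
      show ?case
      proof
        fix y :: "real \<times> real" assume "y \<in> cball 0 R"
        then have "\<bar>?r y\<bar> \<le> real n" using ridge_le[of y] elim by simp
        from approx[OF this] elim show "dist (q n (?r y)) (f (?r y)) < e"
          by (simp add: dist_real_def abs_minus_commute)
      qed
    qed
  qed
  moreover have "real_polynomial_function (\<lambda>x. q n (?r x))" for n
    using real_polynomial_function_compose[OF _ q[of n], of ?r] real_polynomial_function_ridge[of a b]
    by (simp add: real_polynomial_function_eq o_def)
  moreover have "continuous_on UNIV (\<lambda>x. f (?r x))"
    by (intro continuous_on_compose2[OF f] continuous_intros) auto
  ultimately have "converges_on_discs (\<lambda>n. V (\<lambda>x. q n (?r x))) (V (\<lambda>x. f (?r x)))"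
    using V by (simp add: intertwining_operator_def)
  \<comment> \<open>The radius is enlarged by one since discs must have positive radius and
    \<open>x\<close> may be the origin.\<close>
  then have "uniform_limit (cball 0 (norm x + 1)) (\<lambda>n. V (\<lambda>x. q n (?r x))) (V (\<lambda>x. f (?r x))) sequentially"
    by (simp add: converges_on_discs_def add_nonneg_pos)
  then have lim1: "(\<lambda>n. V (\<lambda>x. q n (?r x)) x) \<longlonglongrightarrow> V (\<lambda>x. f (?r x)) x"
    by (rule tendsto_uniform_limitI) simp

  have Vq: "has_bochner_integral ?L (\<lambda>u. ?A * (q n (simplex_ridge k p x u) * ?w u)) (V (\<lambda>x. q n (?r x)) x)" for n
    unfolding a_def b_def using V
    by (intro intertwining_ridge_polynomial k lam q) (simp add: intertwining_operator_def)
  have A: "?A \<ge> 0"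
    unfolding a_const_def using lam
    by (intro divide_nonneg_nonneg mult_nonneg_nonneg zero_le_power less_imp_le[OF Gamma_real_pos])
      (auto intro: add_nonneg_pos)
  let ?If = "?A * (\<integral>u. f (simplex_ridge k p x u) * ?w u \<partial>?L)"
  have If: "has_bochner_integral ?L (\<lambda>u. ?A * (f (simplex_ridge k p x u) * ?w u)) ?If"
    using int by (intro has_bochner_integral_mult_right has_bochner_integral_integrable)
  have "norm (?If - V (\<lambda>x. q n (?r x)) x) \<le> inverse (real (Suc n))" if n: "norm x \<le> real n" for n
  proof -
    have diff: "has_bochner_integral ?L
        (\<lambda>u. ?A * (f (simplex_ridge k p x u) * ?w u) - ?A * (q n (simplex_ridge k p x u) * ?w u))
        (?If - V (\<lambda>x. q n (?r x)) x)"
      by (intro has_bochner_integral_diff If Vq)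
    have bound: "has_bochner_integral ?L (\<lambda>u. inverse (real (Suc n)) * (?A * ?w u)) (inverse (real (Suc n)) * 1)"
      by (intro has_bochner_integral_mult_right has_bochner_integral_ridge_weight k lam)
    \<comment> \<open>Where the weight is nonzero the argument lies in \<open>[-n, n]\<close>, where
      the approximation is good. Integrating this bound against the normalized weight of mass one
      keeps the error at \<open>inverse (real (Suc n))\<close>.\<close>
    have "norm (?A * (f (simplex_ridge k p x u) * ?w u) - ?A * (q n (simplex_ridge k p x u) * ?w u))
        \<le> inverse (real (Suc n)) * (?A * ?w u)" for u
    proof (cases "?w u = 0")
      case False
      then have "\<bar>simplex_ridge k p x u\<bar> \<le> real n"
        using abs_simplex_ridge_le[of k lam u p x] k n by simp
      then have "\<bar>f (simplex_ridge k p x u) - q n (simplex_ridge k p x u)\<bar> \<le> inverse (real (Suc n))"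
        using approx by (intro less_imp_le)
      then have "\<bar>f (simplex_ridge k p x u) - q n (simplex_ridge k p x u)\<bar> * (?A * ?w u)
          \<le> inverse (real (Suc n)) * (?A * ?w u)"
        using A by (intro mult_right_mono) auto
      moreover have "norm (?A * (f (simplex_ridge k p x u) * ?w u) - ?A * (q n (simplex_ridge k p x u) * ?w u))
          = \<bar>f (simplex_ridge k p x u) - q n (simplex_ridge k p x u)\<bar> * \<bar>?A * ?w u\<bar>"
        unfolding real_norm_def abs_mult[symmetric] by (simp add: algebra_simps)
      ultimately show ?thesis using A by simp
    qed simp
    then have "norm (integral\<^sup>L ?L (\<lambda>u. ?A * (f (simplex_ridge k p x u) * ?w u) - ?A * (q n (simplex_ridge k p x u) * ?w u)))
        \<le> integral\<^sup>L ?L (\<lambda>u. inverse (real (Suc n)) * (?A * ?w u))"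
      by (intro order.trans[OF integral_norm_bound] integral_mono integrable_norm
          has_bochner_integral_iff[THEN iffD1, OF diff, THEN conjunct1]
          has_bochner_integral_iff[THEN iffD1, OF bound, THEN conjunct1])
    then show ?thesis
      unfolding has_bochner_integral_integral_eq[OF diff] has_bochner_integral_integral_eq[OF bound]
      by simp
  qed
  moreover have "\<forall>\<^sub>F n in sequentially. norm x \<le> real n"
    using filterlim_real_sequentially unfolding filterlim_at_top by blast
  ultimately have "\<forall>\<^sub>F n in sequentially. norm (?If - V (\<lambda>x. q n (?r x)) x) \<le> inverse (real (Suc n))"
    by (auto elim!: eventually_mono)
  then have "(\<lambda>n. ?If - V (\<lambda>x. q n (?r x)) x) \<longlonglongrightarrow> 0"
    by (rule Lim_null_comparison) (rule LIMSEQ_inverse_real_of_nat)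
  then have "(\<lambda>n. ?If - (?If - V (\<lambda>x. q n (?r x)) x)) \<longlonglongrightarrow> ?If - 0"
    by (intro tendsto_intros)
  then have "(\<lambda>n. V (\<lambda>x. q n (?r x)) x) \<longlonglongrightarrow> ?If"
    by simp
  with lim1 show ?thesis
    by (rule LIMSEQ_unique)
qed

theorem theorem1p1:
  fixes k p :: nat and lam :: real and f :: "real \<Rightarrow> real"
    and V :: "(real \<times> real \<Rightarrow> real) \<Rightarrow> (real \<times> real \<Rightarrow> real)"
  assumes "k \<ge> 2" and "lam > 0" and "p \<le> 2 * k - 1"
    and "intertwining_operator k lam V"
    and "f differentiable_on UNIV"
    and "\<And>x1 x2. set_integrable (lebesgue_coords k) (simplex_T k) (ridge_integrand k lam p f x1 x2)"
  shows "(\<forall>x1 x2.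
    V (\<lambda>x. f (cos (real p * pi / real k) * fst x + sin (real p * pi / real k) * snd x)) (x1, x2)
    = a_const k lam *
      (LINT u:simplex_T k|lebesgue_coords k. ridge_integrand k lam p f x1 x2 u))
    \<and> a_const k lam * (LINT u:simplex_T k|lebesgue_coords k. dirichlet_weight k lam u) = 1"
proof (intro conjI allI)
  have k: "k > 0" "k \<ge> 1" using assms(1) by auto
  fix x1 x2
  have "integrable (lebesgue_coords k)
      (\<lambda>u. indicator (simplex_T k) u *\<^sub>R ridge_integrand k lam p f x1 x2 u)"
    using assms(6)[of x1 x2] by (simp add: set_integrable_def)
  \<comment> \<open>The cut-off weight absorbs the indicator of the simplex, so set integrals become
    integrals over the whole space.\<close>
  also have "?this \<longleftrightarrow> integrable (lebesgue_coords k)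
      (\<lambda>u. f (simplex_ridge k p (x1, x2) u) * ridge_weight k lam u)"
    by (intro Bochner_Integration.integrable_cong indicator_mult_ridge_integrand k refl)
  finally have "integrable (lebesgue_coords k)
      (\<lambda>u. f (simplex_ridge k p (x1, x2) u) * ridge_weight k lam u)" .
  moreover have "continuous_on UNIV f"
    using assms(5) by (rule differentiable_imp_continuous_on)
  moreover have "(LINT u:simplex_T k|lebesgue_coords k. ridge_integrand k lam p f x1 x2 u)
      = (\<integral>u. f (simplex_ridge k p (x1, x2) u) * ridge_weight k lam u \<partial>lebesgue_coords k)"
    unfolding set_lebesgue_integral_def
    by (intro Bochner_Integration.integral_cong indicator_mult_ridge_integrand k refl)
  ultimately show "V (\<lambda>x. f (cos (real p * pi / real k) * fst x + sin (real p * pi / real k) * snd x)) (x1, x2)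
    = a_const k lam *
      (LINT u:simplex_T k|lebesgue_coords k. ridge_integrand k lam p f x1 x2 u)"
    using intertwining_ridge[OF k(1) assms(2,4)] by simp
next
  have k: "k > 0" "k \<ge> 1" using assms(1) by auto
  \<comment> \<open>The normalization of \<open>a_const\<close> is the moment of order
    \<open>0\<close>, transferred back to the simplex.\<close>
  have "(LINT u:simplex_T k|lebesgue_coords k. dirichlet_weight k lam u)
      = (\<integral>u. ridge_weight k lam u \<partial>lebesgue_coords k)"
    unfolding set_lebesgue_integral_def
    by (intro Bochner_Integration.integral_cong refl)
      (simp add: indicator_mult_dirichlet_weight[OF k(2)])
  then show "a_const k lam * (LINT u:simplex_T k|lebesgue_coords k. dirichlet_weight k lam u) = 1"
    using has_bochner_integral_ridge_weight[OF k(1) assms(2)]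
    by (simp add: has_bochner_integral_iff)
qed

end
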